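(* For every positive integer $\delta\geq 3$, there exist infinitely many (pairwise non-isomorphic) finite simple undirected graphs $G$ without isolated vertices such that $\delta(G)=\delta$ and $\gamma_t(G)=2\mu^*(G)-\delta+2$.
   Context: $\delta(G)$ is the minimum degree of $G$. A set $S\subseteq V(G)$ is a total dominating set of $G$ if every vertex of $V(G)$ (including those in $S$) is adjacent to a member of $S$; $\gamma_t(G)$ is the minimum cardinality of a total dominating set (defined when $G$ has no isolated vertices). A matching is a set of pairwise disjoint edges; a maximal matching is a matching not contained in a larger matching; $\mu^*(G)$ is the minimum cardinality of a maximal matching of $G$. *)

theory Defs
  imports Main
begin

record 'a ugraph =
  verts :: "'a set"
  edges :: "'a set set"

text \<open>The vertex set is required to be nonempty, so that the minimum degree makes sense.\<close>

definition finite_simple_graph :: "'a ugraph \<Rightarrow> bool" where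
  "finite_simple_graph G \<longleftrightarrow>
     finite (verts G) \<and> verts G \<noteq> {} \<and> (\<forall>e\<in>edges G. e \<subseteq> verts G \<and> card e = 2)"

definition adjacent :: "'a ugraph \<Rightarrow> 'a \<Rightarrow> 'a \<Rightarrow> bool" where
  "adjacent G u v \<longleftrightarrow> {u, v} \<in> edges G"

definition degree :: "'a ugraph \<Rightarrow> 'a \<Rightarrow> nat" where
  "degree G v = card {u \<in> verts G. adjacent G v u}"

definition min_degree :: "'a ugraph \<Rightarrow> nat" where
  "min_degree G = Min (degree G ` verts G)"

definition no_isolated_vertices :: "'a ugraph \<Rightarrow> bool" where
  "no_isolated_vertices G \<longleftrightarrow> (\<forall>v\<in>verts G. \<exists>u\<in>verts G. adjacent G v u)"

definition total_dominating_set :: "'a ugraph \<Rightarrow> 'a set \<Rightarrow> bool" where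
  "total_dominating_set G S \<longleftrightarrow>
     S \<subseteq> verts G \<and> (\<forall>v\<in>verts G. \<exists>u\<in>S. adjacent G v u)"

text \<open>Meaningful only for finite graphs without isolated vertices: otherwise there is no
  total dominating set, or possibly only infinite ones, whose \<^const>\<open>card\<close> is 0.\<close>

definition total_domination_number :: "'a ugraph \<Rightarrow> nat" where
  "total_domination_number G = (LEAST k. \<exists>S. total_dominating_set G S \<and> card S = k)"

definition matching :: "'a ugraph \<Rightarrow> 'a set set \<Rightarrow> bool" where
  "matching G M \<longleftrightarrow> M \<subseteq> edges G \<and> pairwise disjnt M"

definition maximal_matching :: "'a ugraph \<Rightarrow> 'a set set \<Rightarrow> bool" where
  "maximal_matching G M \<longleftrightarrow> matching G M \<and> \<not> (\<exists>M'. matching G M' \<and> M \<subset> M')"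

definition min_maximal_matching_number :: "'a ugraph \<Rightarrow> nat" where
  "min_maximal_matching_number G = (LEAST k. \<exists>M. maximal_matching G M \<and> card M = k)"

definition isomorphic :: "'a ugraph \<Rightarrow> 'b ugraph \<Rightarrow> bool" where
  "isomorphic G H \<longleftrightarrow>
     (\<exists>f. bij_betw f (verts G) (verts H) \<and>
          (\<forall>u\<in>verts G. \<forall>v\<in>verts G. adjacent G u v \<longleftrightarrow> adjacent H (f u) (f v)))"

end

theory Submission
  imports Defs "HOL-Library.Nat_Bijection"
begin

text \<open>Take a perfect matching on a set \<open>A\<close> of \<open>2k\<close> vertices and, for every \<open>\<delta>\<close>-subset \<open>D\<close>
  of \<open>A\<close>, add \<open>2k\<close> pairwise nonadjacent vertices whose neighbourhood is \<open>D\<close>. A maximal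
  matching that misses a vertex of \<open>D\<close> covers all \<open>2k\<close> of these, so every maximal matching
  covers at least \<open>2k\<close> vertices, and the minimum size is \<open>k\<close>. A total dominating set meets
  every \<open>\<delta>\<close>-subset of \<open>A\<close>, so it misses at most \<open>\<delta> - 1\<close> vertices of \<open>A\<close>; it cannot be
  \<open>A\<close> minus \<open>\<delta> - 1\<close> vertices, since their partners would not be dominated, but one further
  vertex suffices to dominate all these partners.\<close>

section \<open>Auxiliary facts on finite sets, isomorphism and maximal matchings\<close>

lemma obtain_card_superset:
  assumes "finite A" "B \<subseteq> A" "card B \<le> n" "n \<le> card A"
  obtains D where "B \<subseteq> D" "D \<subseteq> A" "card D = n"
proof -
  have fB: "finite B"
    using assms(1,2) finite_subset by blast
  have "n - card B \<le> card (A - B)"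
    using assms fB by (simp add: card_Diff_subset)
  then obtain E where E: "E \<subseteq> A - B" "card E = n - card B" "finite E"
    by (meson obtain_subset_with_card_n)
  have "card (B \<union> E) = n"
    using E fB assms(3) by (subst card_Un_disjoint) auto
  then show thesis
    using that[of "B \<union> E"] E assms(2) by auto
qed

lemma isomorphic_card_verts: "isomorphic G H \<Longrightarrow> card (verts G) = card (verts H)"
  unfolding isomorphic_def using bij_betw_same_card by blast

lemma matching_insert:
  assumes "matching G M" "e \<in> edges G" "disjnt e (\<Union>M)"
  shows "matching G (insert e M)"
  using assms unfolding matching_def pairwise_insert by (auto simp: disjnt_def)

text \<open>Otherwise \<open>e\<close> could be added to \<open>M\<close>. Nonemptiness of
  \<open>e\<close> makes the enlargement strict: a member of \<open>M\<close> that is disjoint from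
  the union of \<open>M\<close> would be empty.\<close>

lemma maximal_matching_not_disjnt:
  assumes "maximal_matching G M" "e \<in> edges G" "e \<noteq> {}"
  shows "\<not> disjnt e (\<Union>M)"
proof
  assume *: "disjnt e (\<Union>M)"
  have "e \<notin> M"
    using * assms(3) by (auto simp: disjnt_def)
  then show False
    using assms * matching_insert[of G M e] unfolding maximal_matching_def by blast
qed

text \<open>The edges partition the covered vertices into blocks of size 2, so bounds on matchings
  reduce to counting covered vertices.\<close>

lemma card_Union_matching:
  assumes "finite_simple_graph G" "matching G M"
  shows "card (\<Union>M) = 2 * card M"
proof -
  have "finite (\<Union>M)"
    using assms unfolding finite_simple_graph_def matching_def
    by (meson Sup_least finite_subset subset_iff)
  then have "2 * card M = card (\<Union>M)"
    using assms unfolding finite_simple_graph_def matching_def pairwise_def disjnt_def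
    by (intro card_partition) (auto dest: finite_UnionD)
  then show ?thesis by simp
qed

text \<open>The fixed-point-free involution \<open>p\<close> encodes the perfect matching on
  \<open>A\<close>, and \<open>N\<close> gives the neighbourhoods of the added vertices
  \<open>W\<close>. Keeping \<open>W\<close> and \<open>N\<close> abstract separates the graph
  argument from the later coding by natural numbers.\<close>

locale matched_blowup =
  fixes A W :: "'a set" and p :: "'a \<Rightarrow> 'a" and N :: "'a \<Rightarrow> 'a set" and \<delta> k :: nat
  assumes finite_A: "finite A" and finite_W: "finite W" and disjoint: "A \<inter> W = {}"
    and p_in: "\<And>x. x \<in> A \<Longrightarrow> p x \<in> A"
    and p_neq: "\<And>x. x \<in> A \<Longrightarrow> p x \<noteq> x"
    and p_p: "\<And>x. x \<in> A \<Longrightarrow> p (p x) = x"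
    and card_A: "card A = 2 * k"
    and \<delta>_ge: "2 \<le> \<delta>" and \<delta>_le: "\<delta> \<le> 2 * k"
    and N_sub: "\<And>w. w \<in> W \<Longrightarrow> N w \<subseteq> A"
    and card_N: "\<And>w. w \<in> W \<Longrightarrow> card (N w) = \<delta>"
    and copies: "\<And>D. D \<subseteq> A \<Longrightarrow> card D = \<delta> \<Longrightarrow> 2 * k \<le> card {w \<in> W. N w = D}"
begin

section \<open>The graph and its adjacency relation\<close>

definition base_edges :: "'a set set" where
  "base_edges = (\<lambda>x. {x, p x}) ` A"

definition G :: "'a ugraph" where
  "G = \<lparr>verts = A \<union> W, edges = base_edges \<union> {{x, w} |x w. w \<in> W \<and> x \<in> N w}\<rparr>"

lemma verts_G [simp]: "verts G = A \<union> W"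
  by (simp add: G_def)

lemma edges_G: "edges G = base_edges \<union> {{x, w} |x w. w \<in> W \<and> x \<in> N w}"
  by (simp add: G_def)

lemma adjacent_G:
  "adjacent G u v \<longleftrightarrow> (u \<in> A \<and> v = p u) \<or> (v \<in> W \<and> u \<in> N v) \<or> (u \<in> W \<and> v \<in> N u)"
  unfolding adjacent_def edges_G base_edges_def
  using p_in p_p by (auto simp: doubleton_eq_iff)

lemma adjacent_W: "w \<in> W \<Longrightarrow> adjacent G w u \<longleftrightarrow> u \<in> N w"
  using disjoint N_sub by (auto simp: adjacent_G)

lemma exists_copy:
  assumes "D \<subseteq> A" "card D = \<delta>"
  obtains w where "w \<in> W" "N w = D"
proof -
  have "0 < card {w \<in> W. N w = D}"
    using copies[OF assms] \<delta>_ge \<delta>_le by linarith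
  then have "{w \<in> W. N w = D} \<noteq> {}"
    unfolding card_gt_0_iff by blast
  then show thesis using that by auto
qed

lemma obtain_\<delta>_superset:
  assumes "B \<subseteq> A" "card B \<le> \<delta>"
  obtains D where "B \<subseteq> D" "D \<subseteq> A" "card D = \<delta>"
  using obtain_card_superset[OF finite_A assms(1,2)] \<delta>_le card_A by auto

lemma finite_simple_graph_G: "finite_simple_graph G"
proof -
  have "A \<noteq> {}"
    using card_A \<delta>_ge \<delta>_le by auto
  moreover have "e \<subseteq> A \<union> W \<and> card e = 2" if "e \<in> edges G" for e
    using that unfolding edges_G base_edges_def
  proof (elim UnE imageE CollectE exE conjE)
    fix x assume "e = {x, p x}" "x \<in> A"
    then show ?thesis using p_in p_neq[of x] by auto
  next
    fix x w assume e: "e = {x, w}" "w \<in> W" "x \<in> N w"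
    then have "x \<in> A" using N_sub by auto
    then have "x \<noteq> w" using e(2) disjoint by blast
    then show ?thesis using e \<open>x \<in> A\<close> by auto
  qed
  ultimately show ?thesis
    using finite_A finite_W by (auto simp: finite_simple_graph_def)
qed

lemma no_isolated_vertices_G: "no_isolated_vertices G"
  unfolding no_isolated_vertices_def
proof
  fix v assume "v \<in> verts G"
  then consider "v \<in> A" | "v \<in> W" by auto
  then show "\<exists>u\<in>verts G. adjacent G v u"
  proof cases
    case 1
    then show ?thesis using p_in by (auto simp: adjacent_G)
  next
    case 2
    then have "N v \<noteq> {}" using card_N \<delta>_ge by fastforce
    then show ?thesis using 2 N_sub by (auto simp: adjacent_W)
  qed
qed

section \<open>Minimum degree\<close>

lemma degree_W: "w \<in> W \<Longrightarrow> degree G w = \<delta>"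
proof -
  assume w: "w \<in> W"
  then have "{u \<in> verts G. adjacent G w u} = N w"
    using N_sub by (auto simp: adjacent_W)
  then show ?thesis by (simp add: degree_def card_N w)
qed

text \<open>Some \<open>\<delta>\<close>-subset of \<open>A\<close> contains \<open>v\<close>, and
  all of its copies, at least \<open>2 * k \<ge> \<delta>\<close> many, are neighbours of
  \<open>v\<close>.\<close>

lemma degree_A: "v \<in> A \<Longrightarrow> \<delta> \<le> degree G v"
proof -
  assume v: "v \<in> A"
  then obtain D where D: "{v} \<subseteq> D" "D \<subseteq> A" "card D = \<delta>"
    using obtain_\<delta>_superset[of "{v}"] \<delta>_ge by auto
  have "card {w \<in> W. N w = D} \<le> degree G v"
    unfolding degree_def using finite_A finite_W D
    by (intro card_mono) (auto simp: adjacent_G)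
  then show ?thesis using copies[OF D(2,3)] \<delta>_le by linarith
qed

lemma min_degree_G: "min_degree G = \<delta>"
  unfolding min_degree_def
proof (rule Min_eqI)
  show "finite (degree G ` verts G)"
    using finite_A finite_W by simp
  show "\<delta> \<le> d" if "d \<in> degree G ` verts G" for d
    using that degree_A degree_W by auto
  obtain D where "D \<subseteq> A" "card D = \<delta>"
    using obtain_\<delta>_superset[of "{}"] by auto
  then obtain w where "w \<in> W" using exists_copy by metis
  then show "\<delta> \<in> degree G ` verts G"
    using degree_W by force
qed

section \<open>Minimum maximal matchings\<close>

lemma Union_base_edges: "\<Union>base_edges = A"
  using p_in by (auto simp: base_edges_def)

lemma matching_base_edges: "matching G base_edges"
  unfolding matching_def pairwise_def
proof (intro conjI ballI impI)
  show "base_edges \<subseteq> edges G" by (simp add: edges_G)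
  fix e f assume "e \<in> base_edges" "f \<in> base_edges" "e \<noteq> f"
  \<comment> \<open>A base edge is determined by either of its ends, so two base edges sharing a
    vertex coincide.\<close>
  moreover have "e = {x, p x}" if "e \<in> base_edges" "x \<in> e" for e x
    using that p_p by (auto simp: base_edges_def)
  ultimately show "disjnt e f"
    unfolding disjnt_iff by metis
qed

text \<open>Every edge of \<open>G\<close> has an end in \<open>A\<close>, and the base edges
  already cover \<open>A\<close>.\<close>

lemma maximal_matching_base_edges: "maximal_matching G base_edges"
  unfolding maximal_matching_def
proof (intro conjI notI matching_base_edges)
  assume "\<exists>M'. matching G M' \<and> base_edges \<subset> M'"
  then obtain M e where M: "matching G M" "base_edges \<subset> M" "e \<in> M" "e \<notin> base_edges"
    by blast
  have "e \<in> edges G" using M by (auto simp: matching_def)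
  then obtain x where x: "x \<in> e" "x \<in> A"
    using M(4) N_sub by (auto simp: edges_G)
  then obtain f where "f \<in> base_edges" "x \<in> f"
    using Union_base_edges by blast
  then have "f \<in> M" "f \<noteq> e" "\<not> disjnt e f"
    using M x by (auto simp: disjnt_def)
  then show False
    using M by (auto simp: matching_def pairwise_def)
qed

lemma min_maximal_matching_number_G: "min_maximal_matching_number G = k"
  unfolding min_maximal_matching_number_def
proof (rule Least_equality)
  have "card base_edges = k"
    using card_Union_matching[OF finite_simple_graph_G matching_base_edges]
    by (simp add: Union_base_edges card_A)
  then show "\<exists>M. maximal_matching G M \<and> card M = k"
    using maximal_matching_base_edges by blast
next
  fix m assume "\<exists>M. maximal_matching G M \<and> card M = m"
  then obtain M where M: "maximal_matching G M" "card M = m" by blast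
  then have mM: "matching G M" by (simp add: maximal_matching_def)
  have "\<Union>M \<subseteq> verts G"
    using mM finite_simple_graph_G by (auto simp: matching_def finite_simple_graph_def)
  then have fin: "finite (\<Union>M)"
    using finite_A finite_W finite_subset by auto
  have "2 * k \<le> card (\<Union>M)"
  proof (cases "A \<subseteq> \<Union>M")
    case True
    then show ?thesis using card_mono[OF fin] card_A by metis
  next
    case False
    then obtain v where v: "v \<in> A" "v \<notin> \<Union>M" by blast
    obtain D where D: "{v} \<subseteq> D" "D \<subseteq> A" "card D = \<delta>"
      using obtain_\<delta>_superset[of "{v}"] \<delta>_ge v by auto
    \<comment> \<open>Maximality forces \<open>M\<close> to meet each edge \<open>{v, w}\<close>; as
      \<open>v\<close> is uncovered, it must do so at \<open>w\<close>.\<close>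
    have "w \<in> \<Union>M" if "w \<in> W" "N w = D" for w
    proof -
      have "{v, w} \<in> edges G" using that D by (auto simp: edges_G)
      then have "\<not> disjnt {v, w} (\<Union>M)"
        using maximal_matching_not_disjnt[OF M(1)] by blast
      then show ?thesis using v by (auto simp: disjnt_def)
    qed
    then have "card {w \<in> W. N w = D} \<le> card (\<Union>M)"
      by (intro card_mono[OF fin]) blast
    then show ?thesis using copies[OF D(2,3)] by linarith
  qed
  then show "k \<le> m"
    using card_Union_matching[OF finite_simple_graph_G mM] M(2) by simp
qed

section \<open>Total domination number\<close>

lemma exists_total_dominating_set:
  "\<exists>S. total_dominating_set G S \<and> card S = 2 * k - \<delta> + 2"
proof -
  obtain T where T: "T \<subseteq> A" "card T = \<delta> - 1" "finite T"
    using obtain_subset_with_card_n[of "\<delta> - 1" A] \<delta>_le card_A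
    by (metis diff_le_self le_trans)
  \<comment> \<open>Only the partners of vertices in \<open>T\<close> lose their neighbour in
    \<open>A\<close>. There are few enough of them to fit into one \<open>\<delta>\<close>-set
    \<open>D\<close>, so a single copy \<open>x\<close> of \<open>D\<close> dominates them
    all.\<close>
  have "card (p ` T) \<le> \<delta>"
    using card_image_le[OF T(3), of p] T(2) by linarith
  then obtain D where D: "p ` T \<subseteq> D" "D \<subseteq> A" "card D = \<delta>"
    using obtain_\<delta>_superset[of "p ` T"] T(1) p_in by blast
  then obtain x where x: "x \<in> W" "N x = D" using exists_copy by metis
  define S where "S = insert x (A - T)"
  have "x \<notin> A" using x disjoint by auto
  then have "card S = Suc (2 * k - (\<delta> - 1))"
    using T finite_A card_A by (simp add: S_def card_Diff_subset)
  then have "card S = 2 * k - \<delta> + 2"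
    using \<delta>_ge \<delta>_le by simp
  moreover have "total_dominating_set G S"
    unfolding total_dominating_set_def
  proof (intro conjI ballI)
    show "S \<subseteq> verts G" using x by (auto simp: S_def)
    fix v assume "v \<in> verts G"
    then consider "v \<in> A" "p v \<in> T" | "v \<in> A" "p v \<notin> T" | "v \<in> W" by auto
    then show "\<exists>u\<in>S. adjacent G v u"
    proof cases
      case 1
      then have "v \<in> D" using D(1) p_p by force
      then show ?thesis using x by (auto simp: S_def adjacent_G)
    next
      case 2
      then show ?thesis using p_in by (auto simp: S_def adjacent_G)
    next
      case 3
      have "card T < card (N v)" using T(2) card_N[OF 3] \<delta>_ge by simp
      then have "\<not> N v \<subseteq> T" using card_mono[OF T(3)] by (metis not_le)
      then show ?thesis using 3 N_sub by (auto simp: S_def adjacent_W)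
    qed
  qed
  ultimately show ?thesis by blast
qed

lemma card_total_dominating_set_ge:
  assumes "total_dominating_set G S"
  shows "2 * k - \<delta> + 2 \<le> card S"
proof (rule ccontr)
  assume small: "\<not> 2 * k - \<delta> + 2 \<le> card S"
  have SV: "S \<subseteq> A \<union> W" and dom: "\<And>v. v \<in> A \<union> W \<Longrightarrow> \<exists>u\<in>S. adjacent G v u"
    using assms by (auto simp: total_dominating_set_def)
  have fS: "finite S" using SV finite_A finite_W finite_subset by blast
  \<comment> \<open>If \<open>S\<close> missed a whole \<open>\<delta>\<close>-subset of
    \<open>A\<close>, a copy of that subset would have no neighbour in \<open>S\<close>.\<close>
  have T_less: "card (A - S) < \<delta>"
  proof (rule ccontr)
    assume "\<not> card (A - S) < \<delta>"
    then obtain D where D: "D \<subseteq> A - S" "card D = \<delta>"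
      by (meson not_less obtain_subset_with_card_n)
    then obtain w where "w \<in> W" "N w = D" using exists_copy[of D] by blast
    then show False using dom[of w] D by (auto simp: adjacent_W)
  qed
  have split: "card (A - S) + card (S \<inter> A) = 2 * k"
    using card_A finite_A by (metis Int_commute add.commute card_Int_Diff)
  have le: "card (S \<inter> A) \<le> card S"
    using fS by (simp add: card_mono)
  \<comment> \<open>By \<open>T_less\<close>, \<open>S\<close> has at least
    \<open>2 * k - \<delta> + 1\<close> vertices in \<open>A\<close>, and by \<open>small\<close> it
    has at most that many in total. Hence \<open>S\<close> lies in \<open>A\<close> and misses
    exactly \<open>\<delta> - 1 \<ge> 1\<close> of its vertices.\<close>
  have eq: "card (S \<inter> A) = card S" and "0 < card (A - S)"
    using small T_less split le \<delta>_ge \<delta>_le by linarith+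
  then have "A - S \<noteq> {}" unfolding card_gt_0_iff by blast
  then obtain t where t: "t \<in> A" "t \<notin> S" by blast
  have "S \<subseteq> A" using card_subset_eq[OF fS, of "S \<inter> A"] eq by auto
  obtain u where u: "u \<in> S" "adjacent G (p t) u"
    using dom[of "p t"] p_in t by auto
  \<comment> \<open>Within \<open>A\<close> the only neighbour of \<open>p t\<close> is its partner
    \<open>t\<close>, which is not in \<open>S\<close>.\<close>
  then have "u = p (p t)"
    using \<open>S \<subseteq> A\<close> disjoint p_in[OF t(1)] by (auto simp: adjacent_G)
  then show False using t u p_p by simp
qed

lemma total_domination_number_G: "total_domination_number G = 2 * k - \<delta> + 2"
  unfolding total_domination_number_def
  by (rule Least_equality) (use exists_total_dominating_set card_total_dominating_set_ge in auto)

end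

section \<open>Realization on the natural numbers\<close>

definition subset_copies :: "nat \<Rightarrow> nat \<Rightarrow> (nat set \<times> nat) set" where
  "subset_copies \<delta> k = {D. D \<subseteq> {..<2 * k} \<and> card D = \<delta>} \<times> {..<2 * k}"

text \<open>The shift by \<open>2 * k\<close> keeps the codes of the copies apart from the base
  vertices \<open>{..<2 * k}\<close>.\<close>

definition copy_vertex :: "nat \<Rightarrow> nat set \<times> nat \<Rightarrow> nat" where
  "copy_vertex k = (\<lambda>(D, j). 2 * k + prod_encode (set_encode D, j))"

definition copy_nbrs :: "nat \<Rightarrow> nat \<Rightarrow> nat set" where
  "copy_nbrs k w = set_decode (fst (prod_decode (w - 2 * k)))"

text \<open>This swaps \<open>2 * i\<close> and \<open>2 * i + 1\<close>; the subtraction is applied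
  to odd numbers only and so never truncates.\<close>

definition partner :: "nat \<Rightarrow> nat" where
  "partner x = (if even x then x + 1 else x - 1)"

lemma finite_subset_copies: "finite (subset_copies \<delta> k)"
proof -
  have "finite {D. D \<subseteq> {..<2 * k} \<and> card D = \<delta>}"
    by (rule finite_subset[of _ "Pow {..<2 * k}"]) auto
  then show ?thesis by (simp add: subset_copies_def)
qed

lemma copy_nbrs_copy_vertex:
  "(D, j) \<in> subset_copies \<delta> k \<Longrightarrow> copy_nbrs k (copy_vertex k (D, j)) = D"
proof -
  assume "(D, j) \<in> subset_copies \<delta> k"
  then have "finite D"
    by (auto simp: subset_copies_def dest: finite_subset[OF _ finite_lessThan])
  then show ?thesis by (simp add: copy_nbrs_def copy_vertex_def)
qed

lemma inj_on_copy_vertex: "inj_on (copy_vertex k) (subset_copies \<delta> k)"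
proof (rule inj_onI)
  fix x y assume xy: "x \<in> subset_copies \<delta> k" "y \<in> subset_copies \<delta> k"
    "copy_vertex k x = copy_vertex k y"
  obtain D j E i where [simp]: "x = (D, j)" "y = (E, i)" by fastforce
  have "D = E" using xy copy_nbrs_copy_vertex by (metis \<open>x = (D, j)\<close> \<open>y = (E, i)\<close>)
  then show "x = y" using xy(3) by (simp add: copy_vertex_def prod_encode_eq)
qed

lemma matched_blowup_nat:
  assumes "2 \<le> \<delta>" "\<delta> \<le> 2 * k"
  shows "matched_blowup {..<2 * k} (copy_vertex k ` subset_copies \<delta> k) partner (copy_nbrs k) \<delta> k"
proof
  show "{..<2 * k} \<inter> copy_vertex k ` subset_copies \<delta> k = {}"
    by (auto simp: copy_vertex_def)
  show "partner x \<in> {..<2 * k}" if "x \<in> {..<2 * k}" for x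
    using that by (auto simp: partner_def elim!: evenE)
  show "partner x \<noteq> x" "partner (partner x) = x" for x
    by (auto simp: partner_def elim!: oddE)
  fix D assume D: "D \<subseteq> {..<2 * k}" "card D = \<delta>"
  have sub: "{D} \<times> {..<2 * k} \<subseteq> subset_copies \<delta> k"
    using D by (auto simp: subset_copies_def)
  have "2 * k = card (copy_vertex k ` ({D} \<times> {..<2 * k}))"
    using inj_on_subset[OF inj_on_copy_vertex sub]
    by (simp add: card_image card_cartesian_product del: Sigma_empty1)
  also have "\<dots> \<le> card {w \<in> copy_vertex k ` subset_copies \<delta> k. copy_nbrs k w = D}"
    using sub finite_subset_copies copy_nbrs_copy_vertex by (intro card_mono) auto
  finally show "2 * k \<le> \<dots>" .
qed (use assms finite_subset_copies copy_nbrs_copy_vertex in \<open>auto simp: subset_copies_def\<close>)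

definition blowup_graph :: "nat \<Rightarrow> nat \<Rightarrow> nat ugraph" where
  "blowup_graph \<delta> k = matched_blowup.G {..<2 * k} (copy_vertex k ` subset_copies \<delta> k)
     partner (copy_nbrs k)"

section \<open>Vertex counts and the infinite family\<close>

lemma card_verts_blowup_graph:
  assumes "2 \<le> \<delta>" "\<delta> \<le> 2 * k"
  shows "card (verts (blowup_graph \<delta> k)) = 2 * k + (2 * k choose \<delta>) * (2 * k)"
proof -
  interpret matched_blowup "{..<2 * k}" "copy_vertex k ` subset_copies \<delta> k" partner
    "copy_nbrs k" \<delta> k
    using matched_blowup_nat[OF assms] .
  have "card (verts (blowup_graph \<delta> k)) = 2 * k + card (subset_copies \<delta> k)"
    using finite_W disjoint
    by (simp add: blowup_graph_def card_Un_disjoint card_image inj_on_copy_vertex)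
  then show ?thesis
    by (simp add: subset_copies_def card_cartesian_product n_subsets)
qed

text \<open>The binomial product is monotone and the summand \<open>2 * k\<close> strictly
  increasing. The order of the graph thus tells different values of \<open>k\<close> apart up to
  isomorphism.\<close>

lemma card_verts_blowup_graph_less:
  assumes "2 \<le> \<delta>" "\<delta> \<le> 2 * k" "k < l"
  shows "card (verts (blowup_graph \<delta> k)) < card (verts (blowup_graph \<delta> l))"
proof -
  have "(2 * k choose \<delta>) * (2 * k) \<le> (2 * l choose \<delta>) * (2 * l)"
    using assms by (intro mult_le_mono binomial_right_mono) auto
  then show ?thesis using assms by (simp add: card_verts_blowup_graph)
qed

theorem proposition2p4:
  fixes \<delta> :: nat
  assumes "\<delta> \<ge> 3"
  shows "\<exists>\<G> :: nat ugraph set.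
           infinite \<G> \<and>
           pairwise (\<lambda>G H. \<not> isomorphic G H) \<G> \<and>
           (\<forall>G\<in>\<G>. finite_simple_graph G \<and> no_isolated_vertices G \<and>
              min_degree G = \<delta> \<and>
              int (total_domination_number G) =
                2 * int (min_maximal_matching_number G) - int \<delta> + 2)"
proof (intro exI conjI ballI)
  \<comment> \<open>Starting at \<open>k = \<delta>\<close> guarantees
    \<open>\<delta> \<le> 2 * k\<close>, as the construction requires.\<close>
  let ?\<G> = "blowup_graph \<delta> ` {\<delta>..}"
  have neq: "card (verts (blowup_graph \<delta> k)) \<noteq> card (verts (blowup_graph \<delta> l))"
    if "\<delta> \<le> k" "\<delta> \<le> l" "k \<noteq> l" for k l
    using card_verts_blowup_graph_less[of \<delta> k l] card_verts_blowup_graph_less[of \<delta> l k] that assms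
    by (cases k l rule: linorder_cases) auto
  have "inj_on (blowup_graph \<delta>) {\<delta>..}"
    using neq by (intro inj_onI) (metis atLeast_iff)
  then show "infinite ?\<G>"
    by (simp add: finite_image_iff infinite_Ici)
  show "pairwise (\<lambda>G H. \<not> isomorphic G H) ?\<G>"
    unfolding pairwise_def using neq isomorphic_card_verts by (metis atLeast_iff imageE)
  fix H assume "H \<in> ?\<G>"
  then obtain k where k: "\<delta> \<le> k" "H = blowup_graph \<delta> k" by auto
  interpret matched_blowup "{..<2 * k}" "copy_vertex k ` subset_copies \<delta> k" partner
    "copy_nbrs k" \<delta> k
    using k(1) assms by (intro matched_blowup_nat) auto
  have H: "H = G" by (simp add: k(2) blowup_graph_def)
  show "finite_simple_graph H" "no_isolated_vertices H" "min_degree H = \<delta>"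
    using finite_simple_graph_G no_isolated_vertices_G min_degree_G by (simp_all add: H)
  \<comment> \<open>Since \<open>\<delta> \<le> 2 * k\<close>, the natural-number difference
    \<open>2 * k - \<delta>\<close> agrees with the integer one.\<close>
  show "int (total_domination_number H) = 2 * int (min_maximal_matching_number H) - int \<delta> + 2"
    using \<delta>_le by (simp add: H total_domination_number_G min_maximal_matching_number_G)
qed

end
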